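(* Let the symmetric matrix $C\in\mathbb R^{n\times n}$ be positive definite and let the matrices $A_i\in\mathbb R^{n\times n}$, $i=1,\dots,m$, be symmetric. Then the barrier parameter of the self-concordant function $$\zeta(y)=-\ln\det\Big(C-\sum_{i=1}^my^{(i)}A_i\Big)$$ satisfies $$\nu_\zeta\le\min\Big\{n,\ \sum_{i=1}^m\mathrm{rank}(A_i)\Big\}.$$
   Context: The domain of $\zeta$ is $\{y\in\mathbb R^m: C-\sum_iy^{(i)}A_i\succ0\}$. The barrier parameter $\nu_\zeta$ is the smallest constant $\nu$ such that $\langle\nabla\zeta(y),h\rangle^2\le\nu\langle\nabla^2\zeta(y)h,h\rangle$ for all $y\in\mathrm{dom}\,\zeta$ and $h\in\mathbb R^m$. *)

theory Defs
  imports "HOL-Analysis.Analysis"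
begin

definition gradient :: "(real^'m \<Rightarrow> real) \<Rightarrow> real^'m \<Rightarrow> real^'m" where
  "gradient f y = (THE D. GDERIV f y :> D)"

definition hessian :: "(real^'m \<Rightarrow> real) \<Rightarrow> real^'m \<Rightarrow> real^'m^'m" where
  "hessian f y = jacobian (gradient f) (at y)"

text \<open>
  The constants are required to be nonnegative. For convex \<open>f\<close> this is automatic as soon as the
  Hessian is nonzero at some point of \<open>D\<close>. If, however, \<open>f\<close> is constant on an open set \<open>D\<close>, then
  every real number satisfies the inequality, and the smallest constant is taken to be \<open>0\<close>.
\<close>
definition barrier_constants :: "(real^'m \<Rightarrow> real) \<Rightarrow> (real^'m) set \<Rightarrow> real set" where
  "barrier_constants f D =
    {\<nu>. 0 \<le> \<nu> \<and> (\<forall>y\<in>D. \<forall>h. (gradient f y \<bullet> h)\<^sup>2 \<le> \<nu> * ((hessian f y *v h) \<bullet> h))}"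

text \<open>
  This value is meaningful only if \<open>barrier_constants f D\<close> is nonempty; in that case it
  is the minimum of this set, by the two lemmas below.
\<close>
definition barrier_parameter :: "(real^'m \<Rightarrow> real) \<Rightarrow> (real^'m) set \<Rightarrow> real" where
  "barrier_parameter f D = (LEAST \<nu>. \<nu> \<in> barrier_constants f D)"

lemma closed_barrier_constants: "closed (barrier_constants f D)"
  unfolding barrier_constants_def Ball_def
  by (intro closed_Collect_conj closed_Collect_all closed_Collect_imp open_Collect_const
      closed_Collect_le continuous_intros)

lemma
  assumes "barrier_constants f D \<noteq> {}"
  shows barrier_parameter_in: "barrier_parameter f D \<in> barrier_constants f D"
    and barrier_parameter_le: "\<nu> \<in> barrier_constants f D \<Longrightarrow> barrier_parameter f D \<le> \<nu>"
proof -
  let ?S = "barrier_constants f D"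
  have bdd: "bdd_below ?S"
    by (rule bdd_belowI[of _ 0]) (simp add: barrier_constants_def)
  have Inf: "Inf ?S \<in> ?S"
    using closed_contains_Inf[OF assms bdd closed_barrier_constants] .
  have eq: "barrier_parameter f D = Inf ?S"
    unfolding barrier_parameter_def
    by (rule Least_equality) (use Inf bdd in \<open>auto intro: cInf_lower\<close>)
  show "barrier_parameter f D \<in> ?S"
    using Inf eq by simp
  show "barrier_parameter f D \<le> \<nu>" if "\<nu> \<in> ?S"
    using that bdd eq by (simp add: cInf_lower)
qed

definition positive_definite :: "real^'n^'n \<Rightarrow> bool" where
  "positive_definite M \<longleftrightarrow> transpose M = M \<and> (\<forall>x. x \<noteq> 0 \<longrightarrow> 0 < x \<bullet> (M *v x))"

definition linear_pencil :: "real^'n^'n \<Rightarrow> ('m::finite \<Rightarrow> real^'n^'n) \<Rightarrow> real^'m \<Rightarrow> real^'n^'n" where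
  "linear_pencil C A y = C - (\<Sum>i\<in>UNIV. (y $ i) *\<^sub>R A i)"

definition zeta :: "real^'n^'n \<Rightarrow> ('m::finite \<Rightarrow> real^'n^'n) \<Rightarrow> real^'m \<Rightarrow> real" where
  "zeta C A y = - ln (det (linear_pencil C A y))"

definition dom_zeta :: "real^'n^'n \<Rightarrow> ('m::finite \<Rightarrow> real^'n^'n) \<Rightarrow> (real^'m) set" where
  "dom_zeta C A = {y. positive_definite (linear_pencil C A y)}"

end

theory Submission
  imports Defs
begin

text \<open>
  Fix a point \<open>y\<close> of the domain and a direction \<open>h\<close>, let \<open>S\<close> be the positive definite value
  of the pencil at \<open>y\<close>, and let \<open>H = (\<Sum>i\<in>UNIV. h $ i *\<^sub>R A i)\<close>. The derivatives of the
  logarithm of the determinant and of the matrix inverse (\<open>has_derivative_det\<close>,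
  \<open>has_derivative_matrix_inv\<close>) show that the first and second derivatives of \<open>zeta\<close> in the
  direction \<open>h\<close> are the traces of \<open>matrix_inv S ** H\<close> and of its square.

  Writing \<open>matrix_inv S = L ** transpose L\<close>, these numbers become the trace of the symmetric matrix
  \<open>M = transpose L ** H ** L\<close> and its squared Frobenius norm. The square of the trace of any matrix
  is at most its rank times its squared Frobenius norm
  (\<open>trace_power2_le_rank_mult_inner_self\<close>), because the trace is the inner product of the matrix
  with the projection onto its range. In terms of the eigenvalues of \<open>M\<close>, this is the
  Cauchy--Schwarz inequality for the sum of the nonzero ones.

  Hence any bound on the rank of \<open>H\<close> that holds for all directions is an admissible barrier constant.
  The rank of \<open>H\<close> is at most \<open>CARD('n)\<close>, and by subadditivity it is at most the sum of the
  ranks of the \<open>A i\<close>. One inequality thus yields both bounds of the minimum. It also shows that the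
  set of barrier constants is nonempty, so that the barrier parameter belongs to it.
\<close>

section \<open>Trace, rank and the Frobenius inner product\<close>

lemma bounded_bilinear_matrix_mult:
  "bounded_bilinear ((**) :: real^'n^'m \<Rightarrow> real^'p^'n \<Rightarrow> real^'p^'m)"
  by (simp flip: bilinear_conv_bounded_bilinear
      add: bilinear_def linear_iff vec_eq_iff matrix_matrix_mult_def algebra_simps sum.distrib
        sum_distrib_left)

interpretation matrix_mult: bounded_bilinear "(**) :: real^'n^'m \<Rightarrow> real^'p^'n \<Rightarrow> real^'p^'m"
  by (rule bounded_bilinear_matrix_mult)

lemma inner_eq_trace: "(X :: real^'n^'m) \<bullet> Y = trace (transpose X ** Y)"
  unfolding inner_vec_def trace_def matrix_matrix_mult_def transpose_def
  by simp (rule sum.swap)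

lemma linear_trace: "linear (trace :: real^'n^'n \<Rightarrow> real)"
  by (simp add: linear_iff trace_add) (simp add: trace_def sum_distrib_left)

lemma bounded_linear_trace: "bounded_linear (trace :: real^'n^'n \<Rightarrow> real)"
  using linear_trace by (simp add: linear_conv_bounded_linear)

text \<open>
  The reason is that \<open>M\<close> does not change when it is multiplied from the left by the orthogonal
  projection \<open>P\<close> onto its range. Hence its trace is the Frobenius inner product of \<open>P\<close> and
  \<open>M\<close>, and the Cauchy--Schwarz inequality gives the factor \<open>P \<bullet> P\<close>, which is the trace of
  \<open>P\<close>, that is, the rank of \<open>M\<close>.
\<close>

lemma trace_power2_le_rank_mult_inner_self:
  fixes M :: "real^'n^'n"
  shows "(trace M)\<^sup>2 \<le> real (rank M) * (M \<bullet> M)"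
proof -
  have "subspace (range ((*v) M))"
    by (simp add: linear_subspace_image)
  then obtain B where B: "pairwise orthogonal B" "\<And>b. b \<in> B \<Longrightarrow> norm b = 1"
      "independent B" "card B = dim (range ((*v) M))" "span B = range ((*v) M)"
    by (metis orthonormal_basis_subspace)
  have finB: "finite B"
    using B(3) independent_imp_finite by blast
  define P :: "real^'n^'n" where "P = (\<chi> i j. \<Sum>b\<in>B. b $ i * b $ j)"
  have P: "P *v x = (\<Sum>b\<in>B. (b \<bullet> x) *\<^sub>R b)" for x
    unfolding vec_eq_iff P_def matrix_vector_mult_def
    by (auto simp: inner_vec_def sum_distrib_left sum_distrib_right ac_simps intro: sum.swap)
  have fix_basis: "P *v b = b" if "b \<in> B" for b
  proof -
    have "P *v b = (\<Sum>c\<in>B. if c = b then b else 0)"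
      unfolding P using B(1,2) that
      by (intro sum.cong)
        (auto simp: pairwise_def orthogonal_def norm_eq_1)
    then show ?thesis
      using finB that by simp
  qed
  have "linear ((*v) P)"
    by simp
  then have fix_range: "P *v x = x" if "x \<in> span B" for x
    using linear_eq_on_span[of "(*v) P" "\<lambda>x. x" B x] fix_basis that by (simp add: linear_ident)
  have PM: "P ** M = M"
    unfolding matrix_eq using fix_range B(5) by (simp flip: matrix_vector_mul_assoc)
  have PP: "P ** P = P"
  proof -
    have "P *v x \<in> span B" for x
      unfolding P by (intro span_sum span_scale span_base)
    then show ?thesis
      unfolding matrix_eq using fix_range by (simp flip: matrix_vector_mul_assoc)
  qed
  have symP: "transpose P = P"
    by (simp add: P_def transpose_def vec_eq_iff mult.commute)
  have "trace P = (\<Sum>b\<in>B. b \<bullet> b)"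
    unfolding trace_def P_def inner_vec_def by simp (rule sum.swap)
  also have "\<dots> = real (rank M)"
    using B(2,4) by (simp add: norm_eq_1 rank_dim_range)
  finally have norm_P: "P \<bullet> P = real (rank M)"
    by (simp add: inner_eq_trace symP PP)
  have "(P \<bullet> M)\<^sup>2 \<le> (P \<bullet> P) * (M \<bullet> M)"
    by (rule Cauchy_Schwarz_ineq)
  then show ?thesis
    unfolding norm_P by (simp add: inner_eq_trace[of P M] symP PM)
qed

section \<open>Subadditivity of the rank\<close>

lemma rank_add_le:
  fixes A B :: "real^'n^'m"
  shows "rank (A + B) \<le> rank A + rank B"
proof -
  let ?V = "range ((*v) A)" and ?W = "range ((*v) B)"
  have sub: "subspace ?V" "subspace ?W"
    by (simp_all add: linear_subspace_image)
  have "rank (A + B) \<le> dim {x + y |x y. x \<in> ?V \<and> y \<in> ?W}"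
    unfolding rank_dim_range
    by (rule dim_subset) (auto simp: matrix_vector_mult_add_rdistrib)
  also have "\<dots> \<le> rank A + rank B"
    using dim_sums_Int[OF sub] by (simp add: rank_dim_range)
  finally show ?thesis .
qed

lemma rank_scaleR_le:
  fixes A :: "real^'n^'m"
  shows "rank (c *\<^sub>R A) \<le> rank A"
proof -
  have "c *\<^sub>R A = (c *\<^sub>R mat 1) ** A"
    by (simp add: matrix_mult.scaleR_left)
  then show ?thesis
    by (metis rank_mul_le_right)
qed

lemma rank_sum_scaleR_le:
  fixes A :: "'i \<Rightarrow> real^'n^'m"
  assumes "finite I"
  shows "rank (\<Sum>i\<in>I. c i *\<^sub>R A i) \<le> (\<Sum>i\<in>I. rank (A i))"
  using assms
proof (induction I)
  case (insert i I)
  then show ?case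
    using rank_add_le[of "c i *\<^sub>R A i" "\<Sum>i\<in>I. c i *\<^sub>R A i"] rank_scaleR_le[of "c i" "A i"] by simp
qed simp

section \<open>Factorization of the inverse of a positive definite matrix\<close>

text \<open>
  One Gram--Schmidt step for the inner product \<open>(x, y) \<mapsto> x \<bullet> (S *v y)\<close>: a vector is orthogonal to
  all \<open>v i\<close> in this inner product exactly when it is orthogonal to all \<open>S *v v i\<close> in the usual
  one, and fewer than \<open>CARD('n)\<close> vectors leave such a vector over.
\<close>

lemma positive_definite_orthonormal_extend:
  fixes S :: "real^'n^'n"
  assumes S: "positive_definite S" and "finite I" "card I < CARD('n)"
  obtains x where "x \<bullet> (S *v x) = 1" "\<And>i. i \<in> I \<Longrightarrow> v i \<bullet> (S *v x) = 0" "\<And>i. i \<in> I \<Longrightarrow> x \<bullet> (S *v v i) = 0"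
proof -
  have "dim ((\<lambda>i. S *v v i) ` I) \<le> card I"
    using dim_le_card'[of "(\<lambda>i. S *v v i) ` I"] card_image_le[of I "\<lambda>i. S *v v i"] \<open>finite I\<close>
    by simp
  then have "dim ((\<lambda>i. S *v v i) ` I) < DIM(real^'n)"
    using assms by simp
  then obtain z where z: "z \<noteq> 0" "\<And>y. y \<in> span ((\<lambda>i. S *v v i) ` I) \<Longrightarrow> orthogonal z y"
    by (rule orthogonal_to_subspace_exists) blast
  let ?q = "z \<bullet> (S *v z)"
  have q: "?q > 0"
    using S z(1) by (simp add: positive_definite_def)
  define x where "x = (1 / sqrt ?q) *\<^sub>R z"
  have 1: "x \<bullet> (S *v x) = 1"
    using q by (simp add: x_def matrix_vector_mult_scaleR field_simps)
  have 2: "x \<bullet> (S *v v i) = 0" if "i \<in> I" for i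
    using z(2)[of "S *v v i"] that by (simp add: x_def span_base orthogonal_def)
  have "v i \<bullet> (S *v x) = x \<bullet> (S *v v i)" for i
    using S by (metis positive_definite_def dot_lmul_matrix inner_commute vector_transpose_matrix)
  with 1 2 that show ?thesis
    by simp
qed

lemma positive_definite_orthonormal_family:
  fixes S :: "real^'n^'n"
  assumes S: "positive_definite S"
  obtains v :: "'n \<Rightarrow> real^'n" where "\<And>i j. v i \<bullet> (S *v v j) = (if i = j then 1 else 0)"
proof -
  have "\<exists>v. \<forall>i\<in>I. \<forall>j\<in>I. v i \<bullet> (S *v v j) = (if i = j then 1 else 0)" for I :: "'n set"
    using finite[of I]
  proof (induction I)
    case (insert k I)
    then obtain v :: "'n \<Rightarrow> real^'n" where v: "\<forall>i\<in>I. \<forall>j\<in>I. v i \<bullet> (S *v v j) = (if i = j then 1 else 0)"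
      by blast
    have "card I < CARD('n)"
      using insert(2) by (metis UNIV_I finite psubsetI psubset_card_mono subset_UNIV)
    then obtain x where "x \<bullet> (S *v x) = 1" "\<And>i. i \<in> I \<Longrightarrow> v i \<bullet> (S *v x) = 0"
        "\<And>i. i \<in> I \<Longrightarrow> x \<bullet> (S *v v i) = 0"
      using positive_definite_orthonormal_extend[OF S insert(1)] by blast
    then show ?case
      using v insert(2) by (intro exI[of _ "v(k := x)"]) auto
  qed auto
  from this[of UNIV] that show ?thesis
    by auto
qed

text \<open>
  This replaces the square root of \<open>S\<close>: the columns of \<open>L\<close> are an orthonormal basis for the inner
  product that \<open>S\<close> defines.
\<close>

lemma positive_definite_congruent_identity:
  fixes S :: "real^'n^'n"
  assumes "positive_definite S"
  obtains L :: "real^'n^'n" where "transpose L ** S ** L = mat 1"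
proof -
  obtain v :: "'n \<Rightarrow> real^'n" where v: "\<And>i j. v i \<bullet> (S *v v j) = (if i = j then 1 else 0)"
    using positive_definite_orthonormal_family[OF assms] by blast
  define L :: "real^'n^'n" where "L = (\<chi> i j. v j $ i)"
  have "(transpose L ** (S ** L)) $ i $ j = v i \<bullet> (S *v v j)" for i j
    by (simp add: L_def transpose_def matrix_matrix_mult_def matrix_vector_mult_def inner_vec_def)
  then have "transpose L ** S ** L = mat 1"
    by (simp add: vec_eq_iff mat_def v flip: matrix_mul_assoc)
  then show ?thesis
    using that by blast
qed

lemma positive_definite_det_pos:
  fixes S :: "real^'n^'n"
  assumes "positive_definite S"
  shows "det S > 0"
proof -
  obtain L :: "real^'n^'n" where "transpose L ** S ** L = mat 1"
    using positive_definite_congruent_identity[OF assms] .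
  then have "det (transpose L ** S ** L) = 1"
    by simp
  then have "(det L)\<^sup>2 * det S = 1"
    by (simp add: det_mul power2_eq_square ac_simps)
  then show ?thesis
    by (metis zero_less_mult_iff zero_less_one zero_le_power2 not_less)
qed

lemma matrix_inv_mult:
  fixes S :: "real^'n^'n"
  assumes "det S \<noteq> 0"
  shows "S ** matrix_inv S = mat 1" "matrix_inv S ** S = mat 1"
proof -
  have "\<exists>T. S ** T = mat 1 \<and> T ** S = mat 1"
    using assms by (simp add: invertible_det_nz flip: invertible_def)
  from someI_ex[OF this] show "S ** matrix_inv S = mat 1" "matrix_inv S ** S = mat 1"
    unfolding matrix_inv_def by blast+
qed

lemma matrix_inv_positive_definite_factor:
  fixes S :: "real^'n^'n"
  assumes "positive_definite S"
  obtains L :: "real^'n^'n" where "matrix_inv S = L ** transpose L"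
proof -
  obtain L :: "real^'n^'n" where L: "transpose L ** S ** L = mat 1"
    using positive_definite_congruent_identity[OF assms] .
  \<comment> \<open>A one-sided inverse of a square matrix is two-sided, which moves \<open>L\<close> to the front.\<close>
  have "L ** (transpose L ** S) = mat 1"
    using L matrix_left_right_inverse by blast
  then have "L ** transpose L ** S ** matrix_inv S = matrix_inv S"
    by (simp add: matrix_mul_assoc)
  then have "L ** transpose L = matrix_inv S"
    using matrix_inv_mult(1)[of S] positive_definite_det_pos[OF assms]
    by (simp flip: matrix_mul_assoc)
  then show ?thesis
    using that by metis
qed

text \<open>
  The core inequality. Since the trace is invariant under cyclic permutation, the factorization
  \<open>L ** transpose L\<close> of the inverse turns both traces into the traces of \<open>M\<close> and of
  \<open>M ** M\<close> for the symmetric matrix \<open>M = transpose L ** H ** L\<close>. For symmetric \<open>M\<close> the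
  trace of \<open>M ** M\<close> is \<open>M \<bullet> M\<close>, so that \<open>trace_power2_le_rank_mult_inner_self\<close> applies.
\<close>

lemma trace_matrix_inv_mult_power2_le:
  fixes S H :: "real^'n^'n"
  assumes S: "positive_definite S" and H: "transpose H = H"
  shows "(trace (matrix_inv S ** H))\<^sup>2
    \<le> real (rank H) * trace (matrix_inv S ** H ** matrix_inv S ** H)"
    and "0 \<le> trace (matrix_inv S ** H ** matrix_inv S ** H)"
proof -
  obtain L :: "real^'n^'n" where L: "matrix_inv S = L ** transpose L"
    using matrix_inv_positive_definite_factor[OF S] .
  define M where "M = transpose L ** H ** L"
  have symM: "transpose M = M"
    by (simp add: M_def matrix_transpose_mul H matrix_mul_assoc)
  have 1: "trace (matrix_inv S ** H) = trace M"
    using trace_mul_sym[of L "transpose L ** H"] by (simp add: L M_def matrix_mul_assoc)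
  have 2: "trace (matrix_inv S ** H ** matrix_inv S ** H) = M \<bullet> M"
    using trace_mul_sym[of L "transpose L ** H ** L ** transpose L ** H"]
    unfolding inner_eq_trace symM by (simp add: L M_def matrix_mul_assoc)
  show "0 \<le> trace (matrix_inv S ** H ** matrix_inv S ** H)"
    by (simp add: 2)
  have "rank M \<le> rank H"
    unfolding M_def by (meson order_trans rank_mul_le_left rank_mul_le_right)
  then have "real (rank M) * (M \<bullet> M) \<le> real (rank H) * (M \<bullet> M)"
    by (intro mult_right_mono) auto
  with trace_power2_le_rank_mult_inner_self[of M]
  show "(trace (matrix_inv S ** H))\<^sup>2
    \<le> real (rank H) * trace (matrix_inv S ** H ** matrix_inv S ** H)"
    unfolding 1 2 by linarith
qed

section \<open>Derivatives of the determinant and of the matrix inverse\<close>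

text \<open>
  Differentiating the Leibniz formula by the product rule removes one factor from each product. A
  permutation other than the identity moves at least two indices, so another factor of its product
  is an off-diagonal entry of the identity matrix, and its contribution vanishes.
\<close>

lemma has_derivative_det_identity:
  "(det has_derivative (trace :: real^'n^'n \<Rightarrow> real)) (at (mat 1))"
proof -
  let ?D = "\<lambda>p X. of_int (sign p) * (\<Sum>i\<in>UNIV. X $ i $ p i *
     (\<Prod>j\<in>UNIV - {i}. (mat 1 :: real^'n^'n) $ j $ p j))"
  have "(det has_derivative (\<lambda>X. \<Sum>p | p permutes UNIV. ?D p X)) (at (mat 1))"
    unfolding det_def
    by (intro has_derivative_sum has_derivative_mult_right has_derivative_prod
        bounded_linear.has_derivative[OF bounded_linear_vec_nth] has_derivative_ident)
  moreover have "(\<Sum>p | p permutes UNIV. ?D p X) = trace X" for X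
  proof -
    have "?D p X = 0" if p: "p permutes (UNIV :: 'n set)" and "p \<noteq> id" for p
    proof -
      have moved: "\<exists>j. j \<noteq> i \<and> p j \<noteq> j" for i
      proof (rule ccontr)
        assume "\<nexists>j. j \<noteq> i \<and> p j \<noteq> j"
        then have "p permutes {i}"
          using p by (auto simp: permutes_def)
        with \<open>p \<noteq> id\<close> show False
          by simp
      qed
      have vanish: "(\<Prod>j\<in>UNIV - {i}. (mat 1 :: real^'n^'n) $ j $ p j) = 0" for i
      proof (rule prod_zero)
        obtain j where "j \<noteq> i" "p j \<noteq> j"
          using moved by blast
        then show "\<exists>j\<in>UNIV - {i}. (mat 1 :: real^'n^'n) $ j $ p j = 0"
          by (intro bexI[of _ j]) (auto simp: mat_def)
      qed simp
      show ?thesis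
        unfolding vanish by simp
    qed
    then have "(\<Sum>p | p permutes UNIV. ?D p X) = (\<Sum>p\<in>{id}. ?D p X)"
      by (intro sum.mono_neutral_right) (auto simp: permutes_id)
    also have "\<dots> = trace X"
      by (simp add: trace_def mat_def sign_id)
    finally show ?thesis .
  qed
  ultimately show ?thesis
    by simp
qed

text \<open>
  Jacobi's formula: multiplicativity of the determinant moves the base point to the identity matrix.
\<close>

lemma has_derivative_det:
  fixes S :: "real^'n^'n"
  assumes "det S \<noteq> 0"
  shows "(det has_derivative (\<lambda>X. det S * trace (matrix_inv S ** X))) (at S)"
proof -
  note inv = matrix_inv_mult[OF assms]
  have "((\<lambda>X. det (matrix_inv S ** X)) has_derivative (\<lambda>X. trace (matrix_inv S ** X))) (at S)"
    using has_derivative_det_identity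
    by (intro has_derivative_compose[where f = "(**) (matrix_inv S)" and g = det]
        bounded_linear_imp_has_derivative matrix_mult.bounded_linear_right)
      (simp add: inv)
  then have "((\<lambda>X. det S * det (matrix_inv S ** X)) has_derivative
      (\<lambda>X. det S * trace (matrix_inv S ** X))) (at S)"
    by (rule has_derivative_mult_right)
  then show ?thesis
    by (simp add: matrix_mul_assoc inv flip: det_mul)
qed

lemma open_det_nonzero: "open {S :: real^'n^'n. det S \<noteq> 0}"
proof -
  have "continuous_on UNIV (det :: real^'n^'n \<Rightarrow> real)"
    unfolding det_def by (intro continuous_intros)
  then show ?thesis
    by (intro open_Collect_neq continuous_intros)
qed

lemma differentiable_det_compose:
  fixes f :: "'a::real_normed_vector \<Rightarrow> real^'n^'n"
  assumes "\<And>i j. (\<lambda>x. f x $ i $ j) differentiable (at x within X)"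
  shows "(\<lambda>x. det (f x)) differentiable (at x within X)"
proof -
  have prod: "(\<lambda>x. \<Prod>i\<in>I. f x $ i $ p i) differentiable (at x within X)" for p and I :: "'n set"
    using finite[of I] by induction (auto intro!: differentiable_mult assms)
  show ?thesis
    unfolding det_def by (intro differentiable_sum ballI differentiable_mult differentiable_const prod) simp
qed

text \<open>
  Cramer's rule for the inverse. It shows that the entries of the inverse are differentiable, being
  quotients of determinants.
\<close>

lemma matrix_inv_nth:
  fixes S :: "real^'n^'n"
  assumes "det S \<noteq> 0"
  shows "matrix_inv S $ k $ l = det (\<chi> i j. if j = k then mat 1 $ i $ l else S $ i $ j) / det S"
proof -
  have "(S *v column l (matrix_inv S)) $ i = mat 1 $ i $ l" for i
    using matrix_inv_mult(1)[OF assms]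
    by (simp add: vec_eq_iff matrix_matrix_mult_def matrix_vector_mult_def column_def)
  note col = this
  show ?thesis
    using cramer_lemma[of k S "column l (matrix_inv S)", unfolded col] assms
    by (simp add: column_def cong: if_cong)
qed

lemma differentiable_matrix_inv:
  fixes S :: "real^'n^'n"
  assumes "det S \<noteq> 0"
  shows "matrix_inv differentiable (at S)"
proof -
  have nth: "(\<lambda>T :: real^'n^'n. T $ i $ j) differentiable (at S)" for i j
    by (intro bounded_linear_imp_differentiable bounded_linear_compose[OF bounded_linear_vec_nth]
        bounded_linear_vec_nth)
  let ?c = "\<lambda>k l (T :: real^'n^'n). det (\<chi> i j. if j = k then mat 1 $ i $ l else T $ i $ j) / det T"
  have subst_nth: "(\<lambda>T :: real^'n^'n. if b then c else T $ i $ j) differentiable (at S)" for b c i j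
    using nth by (cases b) auto
  have entry: "(\<lambda>T :: real^'n^'n. matrix_inv T $ k $ l) differentiable (at S)" for k l
  proof -
    have "?c k l differentiable (at S)"
      using assms nth subst_nth by (auto intro!: differentiable_divide differentiable_det_compose)
    then obtain D where "(?c k l has_derivative D) (at S)"
      by (auto simp: differentiable_def)
    then have "((\<lambda>T. matrix_inv T $ k $ l) has_derivative D) (at S)"
      by (rule has_derivative_transform_within_open[OF _ open_det_nonzero])
        (use assms in \<open>auto simp: matrix_inv_nth\<close>)
    then show ?thesis
      by (auto simp: differentiable_def)
  qed
  have "(\<lambda>T :: real^'n^'n. matrix_inv T \<bullet> b) differentiable (at S)" if b: "b \<in> Basis" for b
  proof -
    obtain k l :: 'n where "b = axis k (axis l 1)"
      using b by (auto simp: Basis_vec_def)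
    then show ?thesis
      using entry[of k l] by (simp add: inner_axis)
  qed
  then show ?thesis
    by (rule differentiable_componentwise_within[THEN iffD2, OF ballI])
qed

text \<open>
  Once the inverse is known to be differentiable, the product rule applied to
  \<open>T ** matrix_inv T = mat 1\<close> determines its derivative.
\<close>

lemma has_derivative_matrix_inv:
  fixes S :: "real^'n^'n"
  assumes "det S \<noteq> 0"
  shows "(matrix_inv has_derivative (\<lambda>X. - (matrix_inv S ** X ** matrix_inv S))) (at S)"
proof -
  note inv = matrix_inv_mult[OF assms]
  obtain D where D: "(matrix_inv has_derivative D) (at S)"
    using differentiable_matrix_inv[OF assms] by (auto simp: differentiable_def)
  have prod: "((\<lambda>T. T ** matrix_inv T) has_derivative (\<lambda>X. S ** D X + X ** matrix_inv S)) (at S)"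
    using matrix_mult.FDERIV[OF has_derivative_ident D] .
  have "((\<lambda>T. mat 1) has_derivative (\<lambda>X. S ** D X + X ** matrix_inv S)) (at S)"
    by (rule has_derivative_transform_within_open[OF prod open_det_nonzero])
      (use assms matrix_inv_mult in auto)
  then have "(\<lambda>X. S ** D X + X ** matrix_inv S) = (\<lambda>X. 0)"
    using has_derivative_unique has_derivative_const by blast
  then have "S ** D X = - (X ** matrix_inv S)" for X
    by (metis add_eq_0_iff2)
  then have "matrix_inv S ** (S ** D X) = - (matrix_inv S ** (X ** matrix_inv S))" for X
    by (simp add: matrix_mult.minus_right)
  then have "D X = - (matrix_inv S ** X ** matrix_inv S)" for X
    by (simp add: matrix_mul_assoc inv)
  then have "D = (\<lambda>X. - (matrix_inv S ** X ** matrix_inv S))"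
    by blast
  with D show ?thesis
    by simp
qed

section \<open>Gradient and Hessian of the log-determinant barrier\<close>

lemma has_derivative_linear_pencil:
  "(linear_pencil C A has_derivative (\<lambda>h. - (\<Sum>i\<in>UNIV. h $ i *\<^sub>R A i))) (at y)"
proof -
  have "(linear_pencil C A has_derivative (\<lambda>h. 0 - (\<Sum>i\<in>UNIV. h $ i *\<^sub>R A i))) (at y)"
    unfolding linear_pencil_def
    by (intro has_derivative_diff has_derivative_const has_derivative_sum has_derivative_scaleR_left
        bounded_linear_imp_has_derivative bounded_linear_vec_nth)
  then show ?thesis
    by simp
qed

text \<open>
  A second derivative needs the gradient on a neighbourhood. This open set contains the domain of
  \<open>zeta\<close>, and on it the formula for the gradient is valid.
\<close>

lemma open_det_linear_pencil_pos: "open {y. det (linear_pencil C A y) > 0}"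
proof -
  have "continuous_on UNIV (det :: real^'n^'n \<Rightarrow> real)"
    unfolding det_def by (intro continuous_intros)
  then have "continuous_on UNIV (\<lambda>y. det (linear_pencil C A y))"
    by (rule continuous_on_compose2)
     (auto intro!: continuous_at_imp_continuous_on has_derivative_continuous has_derivative_linear_pencil)
  then show ?thesis
    by (intro open_Collect_less continuous_intros)
qed

lemma gradient_eqI:
  assumes "GDERIV f y :> D"
  shows "gradient f y = D"
  unfolding gradient_def
proof (rule the_equality)
  fix E assume "GDERIV f y :> E"
  then have "(\<lambda>h. h \<bullet> E) = (\<lambda>h. h \<bullet> D)"
    using assms unfolding gderiv_def by (rule has_derivative_unique)
  from fun_cong[OF this] show "E = D"
    by (rule vector_eq_ldot[THEN iffD1, OF allI])
qed (rule assms)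

lemma gradient_zeta:
  assumes "det (linear_pencil C A y) > 0"
  shows "gradient (zeta C A) y = (\<chi> i. trace (matrix_inv (linear_pencil C A y) ** A i))"
proof (rule gradient_eqI)
  let ?S = "linear_pencil C A y" and ?H = "\<lambda>h. \<Sum>i\<in>UNIV. h $ i *\<^sub>R A i"
  have "((\<lambda>y. det (linear_pencil C A y)) has_derivative
      (\<lambda>h. det ?S * trace (matrix_inv ?S ** - ?H h))) (at y)"
    by (rule has_derivative_compose[OF has_derivative_linear_pencil has_derivative_det])
      (use assms in simp)
  then have "(zeta C A has_derivative
      (\<lambda>h. - (det ?S * trace (matrix_inv ?S ** - ?H h) * inverse (det ?S)))) (at y)"
    unfolding zeta_def using assms by (intro has_derivative_minus has_derivative_ln)
  moreover have "- (det ?S * trace (matrix_inv ?S ** - ?H h) * inverse (det ?S))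
    = h \<bullet> (\<chi> i. trace (matrix_inv ?S ** A i))" for h
    using assms
    by (simp add: inner_vec_def matrix_mult.minus_right matrix_mult.sum_right matrix_mult.scaleR_right
        linear_neg[OF linear_trace] linear_sum[OF linear_trace] linear_cmul[OF linear_trace])
  ultimately show "GDERIV (zeta C A) y :> (\<chi> i. trace (matrix_inv ?S ** A i))"
    unfolding gderiv_def by simp
qed

lemma hessian_zeta:
  fixes C :: "real^'n^'n" and A :: "'m::finite \<Rightarrow> real^'n^'n"
  assumes "det (linear_pencil C A y) > 0"
  shows "hessian (zeta C A) y *v h = (\<chi> i. trace (matrix_inv (linear_pencil C A y)
    ** (\<Sum>j\<in>UNIV. h $ j *\<^sub>R A j) ** matrix_inv (linear_pencil C A y) ** A i))"
proof -
  let ?R = "matrix_inv (linear_pencil C A y)" and ?H = "\<lambda>h. \<Sum>i\<in>UNIV. h $ i *\<^sub>R A i"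
  let ?G = "\<lambda>y. \<chi> i. trace (matrix_inv (linear_pencil C A y) ** A i)"
  let ?D = "\<lambda>h. \<chi> i. trace (?R ** ?H h ** ?R ** A i)"
  have "((\<lambda>y. matrix_inv (linear_pencil C A y)) has_derivative
      (\<lambda>h. - (?R ** - ?H h ** ?R))) (at y)"
    using assms
    by (intro has_derivative_compose[OF has_derivative_linear_pencil has_derivative_matrix_inv]) simp
  then have R: "((\<lambda>y. matrix_inv (linear_pencil C A y)) has_derivative (\<lambda>h. ?R ** ?H h ** ?R)) (at y)"
    by (simp add: matrix_mult.minus_right matrix_mult.minus_left)
  have entry: "((\<lambda>y. trace (matrix_inv (linear_pencil C A y) ** A i)) has_derivative
      (\<lambda>h. trace (?R ** ?H h ** ?R ** A i))) (at y)" for i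
    by (intro bounded_linear.has_derivative[OF bounded_linear_trace]
        bounded_linear.has_derivative[OF matrix_mult.bounded_linear_left] R)
  have G: "(?G has_derivative ?D) (at y)"
  proof (rule has_derivative_componentwise_within[of ?G ?D y UNIV, THEN iffD2], rule ballI)
    fix b :: "real^'m" assume "b \<in> Basis"
    then obtain i :: 'm where b: "b = axis i 1"
      by (auto simp: Basis_vec_def)
    show "((\<lambda>y. ?G y \<bullet> b) has_derivative (\<lambda>h. ?D h \<bullet> b)) (at y)"
      unfolding b inner_axis using entry[of i] by simp
  qed
  have deriv: "(gradient (zeta C A) has_derivative ?D) (at y)"
    by (rule has_derivative_transform_within_open[OF G open_det_linear_pencil_pos])
      (use assms in \<open>auto simp: gradient_zeta\<close>)
  have "(gradient (zeta C A) has_derivative (\<lambda>h. hessian (zeta C A) y *v h)) (at y)"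
    unfolding hessian_def by (rule jacobian_works[THEN iffD1, OF differentiableI, OF deriv])
  then have "(\<lambda>h. hessian (zeta C A) y *v h) = ?D"
    by (rule has_derivative_unique[OF _ deriv])
  from fun_cong[OF this, of h] show ?thesis .
qed

section \<open>Bounds on the barrier parameter\<close>

text \<open>
  For \<open>S = linear_pencil C A y\<close> and \<open>H = (\<Sum>i\<in>UNIV. h $ i *\<^sub>R A i)\<close>, the first derivative of
  \<open>zeta\<close> in the direction \<open>h\<close> is the trace of \<open>matrix_inv S ** H\<close>, and the second derivative
  is the trace of the square of this matrix. So the claim is the core inequality
  \<open>trace_matrix_inv_mult_power2_le\<close>.
\<close>

lemma rank_in_barrier_constants_zeta:
  fixes C :: "real^'n^'n" and A :: "'m::finite \<Rightarrow> real^'n^'n"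
  assumes "\<And>i. transpose (A i) = A i"
    and "\<And>h :: real^'m. rank (\<Sum>i\<in>UNIV. h $ i *\<^sub>R A i) \<le> r"
  shows "real r \<in> barrier_constants (zeta C A) (dom_zeta C A)"
  unfolding barrier_constants_def
proof (intro CollectI conjI ballI allI)
  fix y h assume "y \<in> dom_zeta C A"
  define S where "S = linear_pencil C A y"
  define H where "H = (\<Sum>i\<in>UNIV. h $ i *\<^sub>R A i)"
  have S: "positive_definite S"
    using \<open>y \<in> dom_zeta C A\<close> by (simp add: dom_zeta_def S_def)
  then have det: "det (linear_pencil C A y) > 0"
    using positive_definite_det_pos S_def by blast
  have symH: "transpose H = H"
    using assms(1) by (simp add: H_def transpose_def vec_eq_iff)
  have expand: "(\<chi> i. trace (X ** A i)) \<bullet> h = trace (X ** H)" for X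
    by (simp add: inner_vec_def H_def matrix_mult.sum_right matrix_mult.scaleR_right
        linear_sum[OF linear_trace] linear_cmul[OF linear_trace] mult.commute)
  have "(gradient (zeta C A) y \<bullet> h)\<^sup>2 = (trace (matrix_inv S ** H))\<^sup>2"
    by (simp add: gradient_zeta[OF det] expand S_def)
  also have "\<dots> \<le> real (rank H) * trace (matrix_inv S ** H ** matrix_inv S ** H)"
    by (rule trace_matrix_inv_mult_power2_le(1)[OF S symH])
  also have "\<dots> \<le> real r * trace (matrix_inv S ** H ** matrix_inv S ** H)"
    using assms(2)[of h] trace_matrix_inv_mult_power2_le(2)[OF S symH]
    by (intro mult_right_mono) (auto simp: H_def)
  also have "\<dots> = real r * ((hessian (zeta C A) y *v h) \<bullet> h)"
    by (simp add: hessian_zeta[OF det] expand flip: S_def H_def)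
  finally show "(gradient (zeta C A) y \<bullet> h)\<^sup>2 \<le> real r * ((hessian (zeta C A) y *v h) \<bullet> h)" .
qed simp

theorem corollary4:
  fixes C :: "real^'n^'n" and A :: "'m::finite \<Rightarrow> real^'n^'n"
  assumes "positive_definite C"
    and "\<And>i. transpose (A i) = A i"
  shows "barrier_parameter (zeta C A) (dom_zeta C A) \<in> barrier_constants (zeta C A) (dom_zeta C A)
    \<and> barrier_parameter (zeta C A) (dom_zeta C A) \<le> real (min CARD('n) (\<Sum>i\<in>UNIV. rank (A i)))"
proof -
  have "rank (\<Sum>i\<in>UNIV. h $ i *\<^sub>R A i) \<le> min CARD('n) (\<Sum>i\<in>UNIV. rank (A i))" for h :: "real^'m"
    using rank_bound[of "\<Sum>i\<in>UNIV. h $ i *\<^sub>R A i"] rank_sum_scaleR_le[of UNIV "($) h" A] by simp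
  then have mem: "real (min CARD('n) (\<Sum>i\<in>UNIV. rank (A i))) \<in> barrier_constants (zeta C A) (dom_zeta C A)"
    by (rule rank_in_barrier_constants_zeta[OF assms(2)])
  then have "barrier_constants (zeta C A) (dom_zeta C A) \<noteq> {}"
    by blast
  with mem show ?thesis
    using barrier_parameter_in barrier_parameter_le by blast
qed

end
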